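(* Let $k\ge1$ be an integer and let $q,z\in\mathbb{C}$ with $|q|<1$ and $z\ne0$. Then $$\sum_{n_1\ge\cdots\ge n_k\ge0}\frac{(-1)^{\sum_{i=1}^{k}n_i}\,(-1/z)_{n_k+1}(-zq)_{n_k}}{(q)_{n_1-n_2}\cdots(q)_{n_{k-1}-n_k}(q^{n_k+1})_{n_k+1}}\,q^{\sum_{i=1}^{k}\binom{n_i+1}{2}}=\sum_{n=0}^\infty(-1)^{kn}q^{(k+1)\binom{n+1}{2}}\big(z^n+z^{-n-1}\big).$$
   Context: $(a)_n=(a;q)_n=\prod_{j=1}^{n}(1-aq^{j-1})$ for $n\ge0$ (with $(a)_0=1$). Powers of $-1$ are ordinary powers. The sum is over integers $n_1\ge\cdots\ge n_k\ge0$; for $k=1$ the product $(q)_{n_1-n_2}\cdots(q)_{n_{k-1}-n_k}$ is empty and equals $1$. *)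

theory Defs
  imports "HOL-Analysis.Analysis"
begin

definition qpoch :: "complex \<Rightarrow> complex \<Rightarrow> nat \<Rightarrow> complex" where
  "qpoch a q n = (\<Prod>j=1..n. 1 - a * q ^ (j - 1))"

(* Weakly decreasing k-tuples (n_1, ..., n_k) of naturals, encoded as functions on {1..k}
   that take the value undefined elsewhere, so that each tuple is represented exactly once. *)
definition decr_tuples :: "nat \<Rightarrow> (nat \<Rightarrow> nat) set" where
  "decr_tuples k = {n \<in> {1..k} \<rightarrow>\<^sub>E UNIV. \<forall>i\<in>{1..<k}. n i \<ge> n (i + 1)}"

definition lhs_term :: "nat \<Rightarrow> complex \<Rightarrow> complex \<Rightarrow> (nat \<Rightarrow> nat) \<Rightarrow> complex" where
  "lhs_term k q z n =
     (-1) ^ (\<Sum>i=1..k. n i) * qpoch (-1 / z) q (n k + 1) * qpoch (- z * q) q (n k)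
     / ((\<Prod>i\<in>{1..<k}. qpoch q q (n i - n (i + 1))) * qpoch (q ^ (n k + 1)) q (n k + 1))
     * q ^ (\<Sum>i=1..k. (n i + 1) choose 2)"

definition rhs_term :: "nat \<Rightarrow> complex \<Rightarrow> complex \<Rightarrow> nat \<Rightarrow> complex" where
  "rhs_term k q z n =
     (-1) ^ (k * n) * q ^ ((k + 1) * ((n + 1) choose 2)) * (z ^ n + z powi (- int n - 1))"

end

theory Submission
  imports Defs
begin

text \<open>
  Write $w_n = (-1)^n q^{n(n+1)/2}$ and let $S$ be the operator
  $(S g)_N = \sum_{n \le N} w_n g_n / (q)_{N-n}$. Truncating the multiple sum to $n_1 \le N$ with
  the extra factor $1/(q)_{N-n_1}$ and summing from the innermost variable outwards gives
  $(S^k \beta)_N$, where $\beta_n = (-1/z)_{n+1} (-zq)_n / (q^{n+1})_{n+1}$. The finite Jacobi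
  triple product expands $\beta$ in the functions $K_r(n) = (q)_n / ((q)_{n-r} (q)_{n+r+1})$ with
  coefficients $q^{r(r+1)/2} (z^r + z^{-r-1})$, and the $q$-Chu-Vandermonde sum shows
  $S K_r = w_r K_r$. Hence $(S^k \beta)_N$ is an explicit single sum; after multiplication by
  $(q)_N$, dominated convergence for $N \to \infty$ applies on both sides.
\<close>

subsection \<open>Finite q-series\<close>

abbreviation qfact :: "complex \<Rightarrow> nat \<Rightarrow> complex" where
  "qfact q n \<equiv> qpoch q q n"

text \<open>The Gaussian binomial coefficient. The value 0 for \<open>k > N\<close> lets a sum over
  a row run one term too far.\<close>

definition qbinom :: "complex \<Rightarrow> nat \<Rightarrow> nat \<Rightarrow> complex" where
  "qbinom q N k = (if k \<le> N then qfact q N / (qfact q k * qfact q (N - k)) else 0)"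

lemma qpoch_0 [simp]: "qpoch a q 0 = 1"
  by (simp add: qpoch_def)

lemma qpoch_Suc: "qpoch a q (Suc n) = qpoch a q n * (1 - a * q ^ n)"
  by (simp add: qpoch_def)

lemma qpoch_add: "qpoch a q (m + n) = qpoch a q m * qpoch (a * q ^ m) q n"
  by (induction n) (simp_all add: qpoch_Suc power_add mult_ac)

lemma one_minus_power_nonzero:
  fixes q :: complex
  assumes "norm q < 1"
  shows "1 - q * q ^ n \<noteq> 0"
proof
  assume "1 - q * q ^ n = 0"
  then have "q ^ Suc n = 1" by simp
  then have "norm q ^ Suc n = 1" by (metis norm_one norm_power)
  moreover have "norm q ^ Suc n < 1"
    using assms power_Suc_le_self[of "norm q" n] by simp
  ultimately show False by simp
qed

lemma qfact_nonzero: "norm q < 1 \<Longrightarrow> qfact q n \<noteq> 0"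
  by (induction n) (use one_minus_power_nonzero in \<open>auto simp: qpoch_Suc\<close>)

text \<open>Exposes the factor (q)_(2n+1), which later cancels against the Gaussian binomials in row
  2n+1 of the triple product.\<close>

lemma qpoch_shifted_eq:
  assumes "norm q < 1"
  shows "qpoch (q ^ (n + 1)) q (n + 1) = qfact q (2 * n + 1) / qfact q n"
proof -
  have "qfact q (2 * n + 1) = qfact q n * qpoch (q ^ (n + 1)) q (n + 1)"
    using qpoch_add[of q q n "n + 1"] by (simp add: mult_2)
  then show ?thesis
    using qfact_nonzero[OF assms, of n] by simp
qed

section \<open>Gaussian binomials and the two q-Pascal rules\<close>

lemma qbinom_0_right: "norm q < 1 \<Longrightarrow> qbinom q N 0 = 1"
  by (simp add: qbinom_def qfact_nonzero)

lemma qbinom_self: "norm q < 1 \<Longrightarrow> qbinom q N N = 1"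
  by (simp add: qbinom_def qfact_nonzero)

lemma qbinom_symmetric: "k \<le> N \<Longrightarrow> qbinom q N k = qbinom q N (N - k)"
  by (simp add: qbinom_def mult.commute)

text \<open>Over the common denominator (q)_(k+1) (q)_(N-k) this q-Pascal rule reads 1 - q^(N+1) =
  (1 - q^(N-k)) + q^(N-k) (1 - q^(k+1)).\<close>

lemma qbinom_Suc_Suc:
  assumes "norm q < 1" "k \<le> N"
  shows "qbinom q (Suc N) (Suc k) = qbinom q N (Suc k) + q ^ (N - k) * qbinom q N k"
proof (cases "k = N")
  case True
  then show ?thesis using assms by (simp add: qbinom_self) (simp add: qbinom_def)
next
  case False
  \<comment> \<open>With N - k = d + 1 no truncated subtraction is left when denominators are
    cleared.\<close>
  define d where "d = N - Suc k"
  have N: "N = k + Suc d" using False assms by (simp add: d_def)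
  have nz: "qfact q n \<noteq> 0" "1 - q * q ^ n \<noteq> 0" for n
    using assms qfact_nonzero one_minus_power_nonzero by auto
  have 1: "qbinom q (Suc N) (Suc k)
      = qfact q N * (1 - q * q ^ N) / (qfact q k * (1 - q * q ^ k) * (qfact q d * (1 - q * q ^ d)))"
    using N by (simp add: qbinom_def qpoch_Suc)
  have 2: "qbinom q N (Suc k) = qfact q N / (qfact q k * (1 - q * q ^ k) * qfact q d)"
    using N by (simp add: qbinom_def qpoch_Suc)
  have 3: "qbinom q N k = qfact q N / (qfact q k * (qfact q d * (1 - q * q ^ d)))"
    using N by (simp add: qbinom_def qpoch_Suc)
  have 4: "q ^ (N - k) = q * q ^ d" "q ^ N = q * q ^ k * q ^ d"
    using N by (simp_all add: power_add)
  show ?thesis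
    unfolding 1 2 3 4 using nz[of k] nz[of d] by (simp add: divide_simps) (simp add: algebra_simps)
qed

text \<open>The mirror image of the previous rule: complement the lower index by symmetry, apply
  that rule, and complement back.\<close>

lemma qbinom_Suc_Suc':
  assumes "norm q < 1" "k \<le> N"
  shows "qbinom q (Suc N) (Suc k) = q ^ Suc k * qbinom q N (Suc k) + qbinom q N k"
proof (cases "k = N")
  case True
  then show ?thesis using assms by (simp add: qbinom_self) (simp add: qbinom_def)
next
  case False
  then obtain d where N: "N = k + Suc d"
    using assms by (metis add_Suc_right le_imp_less_or_eq less_imp_Suc_add)
  have "qbinom q (Suc N) (Suc k) = qbinom q (Suc N) (Suc d)"
    using qbinom_symmetric[of "Suc k" "Suc N" q] N by simp
  also have "\<dots> = qbinom q N (Suc d) + q ^ Suc k * qbinom q N d"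
    using qbinom_Suc_Suc[of q d N] assms N by (simp add: Suc_diff_le)
  finally show ?thesis
    using qbinom_symmetric[of k N q] qbinom_symmetric[of "Suc k" N q] N by simp
qed

lemma sum_qbinom_shift:
  assumes "norm q < 1"
  shows "(\<Sum>k\<le>N. qbinom q N k * f k) = f 0 + (\<Sum>k\<le>N. qbinom q N (Suc k) * f (Suc k))"
proof -
  have "(\<Sum>k\<le>N. qbinom q N k * f k) = (\<Sum>k\<le>Suc N. qbinom q N k * f k)"
    by (simp add: qbinom_def)
  also have "\<dots> = f 0 + (\<Sum>k\<le>N. qbinom q N (Suc k) * f (Suc k))"
    by (subst sum.atMost_Suc_shift) (simp add: qbinom_0_right assms)
  finally show ?thesis .
qed

text \<open>The first q-Pascal rule summed against an arbitrary \<open>f\<close>; it reduces row N+1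
  to row N in the inductions on \<open>m\<close> and on \<open>b\<close> below.\<close>

lemma sum_qbinom_Suc:
  assumes "norm q < 1"
  shows "(\<Sum>k\<le>Suc N. qbinom q (Suc N) k * f k)
    = (\<Sum>k\<le>N. qbinom q N k * f k) + (\<Sum>k\<le>N. qbinom q N k * (q ^ (N - k) * f (Suc k)))"
proof -
  have "(\<Sum>k\<le>Suc N. qbinom q (Suc N) k * f k)
      = f 0 + (\<Sum>k\<le>N. qbinom q (Suc N) (Suc k) * f (Suc k))"
    by (subst sum.atMost_Suc_shift) (simp add: qbinom_0_right assms)
  also have "\<dots> = f 0 + (\<Sum>k\<le>N. (qbinom q N (Suc k) + q ^ (N - k) * qbinom q N k) * f (Suc k))"
    by (intro arg_cong2[where f = "(+)"] refl sum.cong) (simp_all add: qbinom_Suc_Suc assms)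
  finally show ?thesis
    unfolding sum_qbinom_shift[OF assms, of N f] by (simp add: sum.distrib algebra_simps)
qed

lemma sum_qbinom_Suc':
  assumes "norm q < 1"
  shows "(\<Sum>k\<le>Suc N. qbinom q (Suc N) k * f k)
    = (\<Sum>k\<le>N. qbinom q N k * (q ^ k * f k)) + (\<Sum>k\<le>N. qbinom q N k * f (Suc k))"
proof -
  have "(\<Sum>k\<le>Suc N. qbinom q (Suc N) k * f k)
      = f 0 + (\<Sum>k\<le>N. qbinom q (Suc N) (Suc k) * f (Suc k))"
    by (subst sum.atMost_Suc_shift) (simp add: qbinom_0_right assms)
  also have "\<dots> = f 0 + (\<Sum>k\<le>N. (q ^ Suc k * qbinom q N (Suc k) + qbinom q N k) * f (Suc k))"
    by (intro arg_cong2[where f = "(+)"] refl sum.cong)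
       (simp_all add: qbinom_Suc_Suc' assms del: power_Suc)
  finally show ?thesis
    unfolding sum_qbinom_shift[OF assms, of N "\<lambda>k. q ^ k * f k"]
    by (simp add: sum.distrib algebra_simps)
qed

text \<open>This is the terminating 2phi1 with upper parameters q^(-m), q^(r+1), lower parameter
  q^(r+d+1) and argument q^(d+m), with negative powers cleared. The induction on \<open>m\<close>
  keeps \<open>r\<close> free because the q-Pascal rule also produces the sum at r + 1.\<close>

lemma q_Chu_Vandermonde:
  assumes "norm q < 1"
  shows "(\<Sum>i\<le>m. qbinom q m i * ((-1) ^ i * q ^ ((i choose 2) + d * i)
            * qfact q (r + i) / qfact q (r + d + i)))
    = qfact q r * qpoch (q ^ d) q m / qfact q (r + d + m)"
proof (induction m arbitrary: r)
  case 0
  then show ?case using assms by (simp add: qbinom_0_right binomial_eq_0)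
next
  case (Suc m)
  define f where "f = (\<lambda>r i. (-1) ^ i * q ^ ((i choose 2) + d * i) * qfact q (r + i) / qfact q (r + d + i))"
  have shift: "q ^ (m - i) * f r (Suc i) = - (q ^ (d + m)) * f (Suc r) i" if "i \<le> m" for i
  proof -
    \<comment> \<open>Since C(i+1,2) = C(i,2) + i, the index i cancels from the extra exponent, so
      the shifted term is \<open>f (Suc r) i\<close> times a constant.\<close>
    have "(m - i) + ((Suc i choose 2) + d * Suc i) = (d + m) + ((i choose 2) + d * i)"
      using that by (simp add: numeral_2_eq_2)
    then have "q ^ (m - i) * q ^ ((Suc i choose 2) + d * Suc i) = q ^ (d + m) * q ^ ((i choose 2) + d * i)"
      by (metis power_add)
    then show ?thesis
      by (simp add: f_def mult_ac del: mult_Suc_right)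
  qed
  have nz: "qfact q n \<noteq> 0" "1 - q * q ^ n \<noteq> 0" for n
    using assms qfact_nonzero one_minus_power_nonzero by auto
  have "(\<Sum>i\<le>Suc m. qbinom q (Suc m) i * f r i)
      = (\<Sum>i\<le>m. qbinom q m i * f r i) + (\<Sum>i\<le>m. qbinom q m i * (q ^ (m - i) * f r (Suc i)))"
    by (rule sum_qbinom_Suc[OF assms])
  also have "(\<Sum>i\<le>m. qbinom q m i * (q ^ (m - i) * f r (Suc i)))
      = (\<Sum>i\<le>m. - (q ^ (d + m)) * (qbinom q m i * f (Suc r) i))"
    by (intro sum.cong refl) (simp add: shift)
  also have "\<dots> = - (q ^ (d + m)) * (\<Sum>i\<le>m. qbinom q m i * f (Suc r) i)"
    by (simp add: sum_distrib_left)
  also have "(\<Sum>i\<le>m. qbinom q m i * f (Suc r) i)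
      = qfact q r * (1 - q * q ^ r) * qpoch (q ^ d) q m / (qfact q (r + d + m) * (1 - q * q ^ (r + d + m)))"
    using Suc.IH[of "Suc r"] unfolding f_def by (simp add: qpoch_Suc)
  also have "(\<Sum>i\<le>m. qbinom q m i * f r i) = qfact q r * qpoch (q ^ d) q m / qfact q (r + d + m)"
    using Suc.IH[of r] unfolding f_def .
  \<comment> \<open>The numerators combine by (1 - q^(r+d+m+1)) - q^(d+m) (1 - q^(r+1)) = 1 -
    q^(d+m), the new last factor of the q-product.\<close>
  also have "qfact q r * qpoch (q ^ d) q m / qfact q (r + d + m) + - (q ^ (d + m)) *
       (qfact q r * (1 - q * q ^ r) * qpoch (q ^ d) q m / (qfact q (r + d + m) * (1 - q * q ^ (r + d + m))))
      = qfact q r * qpoch (q ^ d) q (Suc m) / qfact q (r + d + Suc m)"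
    using nz[of "r + d + m"]
    by (simp add: qpoch_Suc divide_simps) (simp add: algebra_simps power_add)
  finally show ?case unfolding f_def .
qed

section \<open>Triangular numbers and the finite Jacobi triple product\<close>

definition tri :: "int \<Rightarrow> nat" where
  "tri r = nat (r * (r + 1) div 2)"

text \<open>A product of two consecutive integers is never negative, so \<open>nat\<close> truncates
  nothing even for r < 0, and \<open>q\<close> can carry a natural exponent.\<close>

lemma int_tri: "int (tri r) = r * (r + 1) div 2"
proof -
  have "r * (r + 1) \<ge> 0"
    by (cases "r \<ge> 0") (auto intro: mult_nonneg_nonneg mult_nonpos_nonpos)
  then show ?thesis by (simp add: tri_def)
qed

lemma int_tri_Suc: "int (tri (r + 1)) = int (tri r) + r + 1"
proof -
  have "(r + 1) * (r + 2) = r * (r + 1) + (r + 1) * 2" by (simp add: algebra_simps)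
  then have "(r + 1) * (r + 2) div 2 = r * (r + 1) div 2 + (r + 1)" by simp
  then show ?thesis unfolding int_tri by (simp add: algebra_simps)
qed

lemma tri_of_nat: "tri (int n) = Suc n choose 2"
proof -
  have "int (tri (int n)) = int (Suc n choose 2)"
    unfolding int_tri choose_two by (simp add: zdiv_int algebra_simps)
  then show ?thesis by simp
qed

lemma tri_reflect: "tri (- r - 1) = tri r"
  by (simp add: tri_def algebra_simps)

text \<open>A new factor 1 + q^a / z is matched by the second q-Pascal rule, a new factor 1 + z
  q^(b+1) by the first. Only \<open>a\<close> moves the centre of the index, so it is built up
  first, at b = 0.\<close>

lemma finite_Jacobi_triple_product:
  assumes "norm q < 1" "z \<noteq> 0"
  shows "qpoch (-1 / z) q a * qpoch (- z * q) q b
    = (\<Sum>k\<le>a + b. qbinom q (a + b) k * (q ^ tri (int k - int a) * z powi (int k - int a)))"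
proof (induction b)
  case 0
  have "qpoch (-1 / z) q a
    = (\<Sum>k\<le>a. qbinom q a k * (q ^ tri (int k - int a) * z powi (int k - int a)))"
  proof (induction a)
    case 0
    then show ?case using assms by (simp add: qbinom_0_right tri_def)
  next
    case (Suc a)
    define f where "f = (\<lambda>k. q ^ tri (int k - int (Suc a)) * z powi (int k - int (Suc a)))"
    define g where "g = (\<lambda>k. q ^ tri (int k - int a) * z powi (int k - int a))"
    have f_Suc: "f (Suc k) = g k" for k
      by (simp add: f_def g_def)
    \<comment> \<open>Because k + tri(k-a-1) = a + tri(k-a), the power q^k from the q-Pascal rule
      turns this sum into q^a / z times the old one.\<close>
    have f_g: "q ^ k * f k = q ^ a / z * g k" for k
    proof -
      have "int (k + tri (int k - int (Suc a))) = int (a + tri (int k - int a))"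
        using int_tri_Suc[of "int k - int (Suc a)"] by (simp add: algebra_simps)
      then have "q ^ k * q ^ tri (int k - int (Suc a)) = q ^ a * q ^ tri (int k - int a)"
        by (metis of_nat_eq_iff power_add)
      moreover have "z powi (int k - int (Suc a)) = z powi (int k - int a) / z"
        using assms power_int_diff[of z "int k - int a" 1] by (simp add: algebra_simps)
      ultimately show ?thesis by (simp add: f_def g_def)
    qed
    have "(\<Sum>k\<le>Suc a. qbinom q (Suc a) k * f k)
        = (\<Sum>k\<le>a. qbinom q a k * (q ^ a / z * g k)) + (\<Sum>k\<le>a. qbinom q a k * g k)"
      unfolding sum_qbinom_Suc'[OF assms(1)] f_Suc f_g ..
    also have "(\<Sum>k\<le>a. qbinom q a k * (q ^ a / z * g k)) = q ^ a / z * (\<Sum>k\<le>a. qbinom q a k * g k)"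
      by (simp add: sum_distrib_left mult_ac)
    also have "(\<Sum>k\<le>a. qbinom q a k * g k) = qpoch (-1 / z) q a"
      using Suc.IH unfolding g_def by simp
    finally show ?case
      unfolding f_def by (simp add: qpoch_Suc algebra_simps)
  qed
  then show ?case by simp
next
  case (Suc b)
  define g where "g = (\<lambda>k. q ^ tri (int k - int a) * z powi (int k - int a))"
  \<comment> \<open>Because (a+b-k) + tri(k+1-a) = (b+1) + tri(k-a), the shifted sum is z q^(b+1)
    times the old one.\<close>
  have g_Suc: "q ^ (a + b - k) * g (Suc k) = z * q ^ Suc b * g k" if "k \<le> a + b" for k
  proof -
    have "int (a + b - k + tri (int (Suc k) - int a)) = int (Suc b + tri (int k - int a))"
      using int_tri_Suc[of "int k - int a"] that by (simp add: algebra_simps of_nat_diff)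
    then have "q ^ (a + b - k) * q ^ tri (int (Suc k) - int a) = q ^ Suc b * q ^ tri (int k - int a)"
      by (metis of_nat_eq_iff power_add)
    moreover have "z powi (int (Suc k) - int a) = z powi (int k - int a) * z"
      using assms power_int_add[of z "int k - int a" 1] by (simp add: algebra_simps)
    ultimately show ?thesis by (simp add: g_def)
  qed
  have "(\<Sum>k\<le>Suc (a + b). qbinom q (Suc (a + b)) k * g k)
      = (\<Sum>k\<le>a + b. qbinom q (a + b) k * g k)
        + (\<Sum>k\<le>a + b. qbinom q (a + b) k * (q ^ (a + b - k) * g (Suc k)))"
    by (rule sum_qbinom_Suc[OF assms(1)])
  also have "(\<Sum>k\<le>a + b. qbinom q (a + b) k * (q ^ (a + b - k) * g (Suc k)))
      = z * q ^ Suc b * (\<Sum>k\<le>a + b. qbinom q (a + b) k * g k)"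
    unfolding sum_distrib_left
    by (intro sum.cong refl, subst g_Suc) (simp_all add: mult_ac)
  also have "(\<Sum>k\<le>a + b. qbinom q (a + b) k * g k) = qpoch (-1 / z) q a * qpoch (- z * q) q b"
    using Suc.IH unfolding g_def by simp
  finally show ?case
    unfolding g_def by (simp add: qpoch_Suc algebra_simps)
qed

subsection \<open>The Bailey chain\<close>

text \<open>
  Everything is Bailey's lemma relative to $a = q$ with $\rho_1 = q$ and $\rho_2 \to \infty$, where
  the sequence $\beta_n$ of a Bailey pair has been multiplied by $(q)_n$ and $\alpha_n$ by $1 - q$.
\<close>

definition bailey_kernel :: "complex \<Rightarrow> nat \<Rightarrow> nat \<Rightarrow> complex" where
  "bailey_kernel q r n =
     (if r \<le> n then qfact q n / (qfact q (n - r) * qfact q (n + r + 1)) else 0)"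

text \<open>The limit of (rho_2)_j (q / rho_2)^j as rho_2 tends to infinity; the factor (rho_1)_j =
  (q)_j is absorbed by the rescaling of beta.\<close>

definition bailey_weight :: "complex \<Rightarrow> nat \<Rightarrow> complex" where
  "bailey_weight q j = (-1) ^ j * q ^ (Suc j choose 2)"

definition bailey_step :: "complex \<Rightarrow> (nat \<Rightarrow> complex) \<Rightarrow> nat \<Rightarrow> complex" where
  "bailey_step q g N = (\<Sum>j\<le>N. bailey_weight q j * g j / qfact q (N - j))"

definition bailey_alpha :: "complex \<Rightarrow> complex \<Rightarrow> nat \<Rightarrow> complex" where
  "bailey_alpha q z r = q ^ (Suc r choose 2) * (z ^ r + z powi (- int r - 1))"

definition bailey_beta :: "complex \<Rightarrow> complex \<Rightarrow> nat \<Rightarrow> complex" where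
  "bailey_beta q z n = qpoch (-1 / z) q (n + 1) * qpoch (- z * q) q n / qpoch (q ^ (n + 1)) q (n + 1)"

text \<open>The triple product with n+1 and n factors has the 2n+2 terms k = 0, ..., 2n+1. The terms
  k = n - r and k = n + 1 + r share their Gaussian binomial and their triangular number and carry
  z^(-r-1) and z^r, so together they give \<open>bailey_alpha q z r\<close>.\<close>

lemma bailey_beta_eq:
  assumes "norm q < 1" "z \<noteq> 0"
  shows "bailey_beta q z n = (\<Sum>r\<le>n. bailey_alpha q z r * bailey_kernel q r n)"
proof -
  define g where "g = (\<lambda>k. qbinom q (2 * n + 1) k
    * (q ^ tri (int k - int (n + 1)) * z powi (int k - int (n + 1))))"
  have kern: "qbinom q (2 * n + 1) (n - r) = qfact q (2 * n + 1) / qfact q n * bailey_kernel q r n"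
    if "r \<le> n" for r
  proof -
    have "2 * n + 1 - (n - r) = n + r + 1" using that by simp
    then show ?thesis
      using that qfact_nonzero[OF assms(1), of n] by (simp add: qbinom_def bailey_kernel_def)
  qed
  have low: "g (n - r) = qfact q (2 * n + 1) / qfact q n * bailey_kernel q r n
      * (q ^ (Suc r choose 2) * z powi (- int r - 1))" if "r \<le> n" for r
  proof -
    have *: "int (n - r) - int (n + 1) = - int r - 1"
      using that by simp
    show ?thesis
      unfolding g_def * kern[OF that] tri_reflect tri_of_nat by simp
  qed
  have high: "g (Suc n + r) = qfact q (2 * n + 1) / qfact q n * bailey_kernel q r n
      * (q ^ (Suc r choose 2) * z ^ r)" if "r \<le> n" for r
  proof -
    have *: "int (Suc n + r) - int (n + 1) = int r" by simp
    have reflect: "qbinom q (2 * n + 1) (Suc n + r) = qbinom q (2 * n + 1) (n - r)"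
      using qbinom_symmetric[of "Suc n + r" "2 * n + 1" q] that by (simp add: algebra_simps)
    show ?thesis
      unfolding g_def * reflect kern[OF that] tri_of_nat by simp
  qed
  have "qpoch (-1 / z) q (n + 1) * qpoch (- z * q) q n = (\<Sum>k\<le>2 * n + 1. g k)"
  proof -
    have N: "n + 1 + n = 2 * n + 1" by simp
    show ?thesis
      using finite_Jacobi_triple_product[OF assms, of "n + 1" n] unfolding g_def N .
  qed
  \<comment> \<open>The lower half is reindexed by k = n - r, the upper half by k = n + 1 + r, both
    with r from 0 to n.\<close>
  also have "{..2 * n + 1} = {..n} \<union> {Suc n..Suc n + n}" by auto
  also have "(\<Sum>k\<in>{..n} \<union> {Suc n..Suc n + n}. g k) = (\<Sum>k\<le>n. g k) + (\<Sum>k=Suc n..Suc n + n. g k)"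
    by (rule sum.union_disjoint) auto
  also have "(\<Sum>k\<le>n. g k) = (\<Sum>r\<le>n. g (n - r))"
    by (rule sum.reindex_bij_witness[of _ "\<lambda>r. n - r" "\<lambda>r. n - r"]) auto
  also have "(\<Sum>k=Suc n..Suc n + n. g k) = (\<Sum>r\<le>n. g (Suc n + r))"
    by (rule sum.reindex_bij_witness[of _ "\<lambda>r. Suc n + r" "\<lambda>k. k - Suc n"]) auto
  also have "(\<Sum>r\<le>n. g (n - r)) + (\<Sum>r\<le>n. g (Suc n + r))
      = (\<Sum>r\<le>n. qfact q (2 * n + 1) / qfact q n * (bailey_alpha q z r * bailey_kernel q r n))"
    unfolding sum.distrib[symmetric]
    by (intro sum.cong refl) (simp only: atMost_iff low high, simp add: bailey_alpha_def algebra_simps del: binomial_Suc_Suc)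
  finally have "qpoch (-1 / z) q (n + 1) * qpoch (- z * q) q n
      = qfact q (2 * n + 1) / qfact q n * (\<Sum>r\<le>n. bailey_alpha q z r * bailey_kernel q r n)"
    by (simp add: sum_distrib_left)
  then show ?thesis
    unfolding bailey_beta_def qpoch_shifted_eq[OF assms(1)] using qfact_nonzero[OF assms(1)] by simp
qed

text \<open>Splits the exponent of the weight at j = r + i into a constant part and the
  q-Chu-Vandermonde exponent with d = r + 1.\<close>

lemma choose_two_add: "Suc (r + i) choose 2 = (Suc r choose 2) + ((i choose 2) + Suc r * i)"
  by (induction i) (simp_all add: numeral_2_eq_2)

text \<open>The kernels are eigenfunctions of the step. Terms with j < r vanish, and the rest, with
  j = r + i, form a q-Chu-Vandermonde sum with m = n - r and d = r + 1.\<close>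

lemma bailey_step_kernel:
  assumes "norm q < 1"
  shows "bailey_step q (bailey_kernel q r) n = bailey_weight q r * bailey_kernel q r n"
proof (cases "r \<le> n")
  case False
  then show ?thesis by (simp add: bailey_step_def bailey_kernel_def)
next
  case True
  define m where "m = n - r"
  have n: "n = r + m" using True by (simp add: m_def)
  have nz: "qfact q n \<noteq> 0" for n
    using assms qfact_nonzero by auto
  have "bailey_step q (bailey_kernel q r) n
      = (\<Sum>j\<in>{r..n}. bailey_weight q j * bailey_kernel q r j / qfact q (n - j))"
    unfolding bailey_step_def by (rule sum.mono_neutral_right) (auto simp: bailey_kernel_def)
  also have "\<dots> = (\<Sum>i\<le>m. bailey_weight q (r + i) * bailey_kernel q r (r + i) / qfact q (m - i))"
    by (rule sum.reindex_bij_witness[of _ "\<lambda>i. r + i" "\<lambda>j. j - r"]) (auto simp: n add.commute)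
  also have "\<dots> = (\<Sum>i\<le>m. bailey_weight q r / qfact q m * (qbinom q m i *
      ((-1) ^ i * q ^ ((i choose 2) + Suc r * i) * qfact q (r + i) / qfact q (r + Suc r + i))))"
  proof (intro sum.cong refl)
    fix i assume "i \<in> {..m}"
    then show "bailey_weight q (r + i) * bailey_kernel q r (r + i) / qfact q (m - i)
      = bailey_weight q r / qfact q m * (qbinom q m i *
      ((-1) ^ i * q ^ ((i choose 2) + Suc r * i) * qfact q (r + i) / qfact q (r + Suc r + i)))"
      using nz[of m] unfolding bailey_weight_def choose_two_add[of r i] power_add[of q "Suc r choose 2"]
      by (simp add: bailey_kernel_def qbinom_def power_add add_ac mult_ac del: binomial_Suc_Suc)
  qed
  also have "\<dots> = bailey_weight q r / qfact q m *
      (qfact q r * qpoch (q ^ Suc r) q m / qfact q (r + Suc r + m))"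
    unfolding sum_distrib_left[symmetric] q_Chu_Vandermonde[OF assms] ..
  also have "qfact q r * qpoch (q ^ Suc r) q m = qfact q n"
    using qpoch_add[of q q r m] by (simp add: n)
  also have "bailey_weight q r / qfact q m * (qfact q n / qfact q (r + Suc r + m))
      = bailey_weight q r * bailey_kernel q r n"
    by (simp add: bailey_kernel_def n add_ac)
  finally show ?thesis .
qed

lemma bailey_step_sum_kernel:
  assumes "norm q < 1"
  shows "bailey_step q (\<lambda>n. \<Sum>r\<le>n. c r * bailey_kernel q r n)
    = (\<lambda>n. \<Sum>r\<le>n. bailey_weight q r * c r * bailey_kernel q r n)"
proof
  fix N
  \<comment> \<open>The kernel vanishes for r > j, so the inner range may be enlarged to r \<le> N;
    it then no longer depends on j and the sums can be swapped.\<close>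
  have "bailey_step q (\<lambda>n. \<Sum>r\<le>n. c r * bailey_kernel q r n) N
      = (\<Sum>j\<le>N. bailey_weight q j * (\<Sum>r\<le>N. c r * bailey_kernel q r j) / qfact q (N - j))"
    unfolding bailey_step_def
    by (intro sum.cong refl arg_cong2[where f = "(/)"] arg_cong2[where f = "(*)"] sum.mono_neutral_left)
       (auto simp: bailey_kernel_def)
  also have "\<dots> = (\<Sum>j\<le>N. \<Sum>r\<le>N. c r * (bailey_weight q j * bailey_kernel q r j / qfact q (N - j)))"
    by (simp add: sum_distrib_left sum_divide_distrib mult_ac)
  also have "\<dots> = (\<Sum>r\<le>N. \<Sum>j\<le>N. c r * (bailey_weight q j * bailey_kernel q r j / qfact q (N - j)))"
    by (rule sum.swap)
  also have "\<dots> = (\<Sum>r\<le>N. c r * bailey_step q (bailey_kernel q r) N)"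
    by (simp add: bailey_step_def sum_distrib_left)
  finally show "bailey_step q (\<lambda>n. \<Sum>r\<le>n. c r * bailey_kernel q r n) N
      = (\<Sum>r\<le>N. bailey_weight q r * c r * bailey_kernel q r N)"
    by (simp add: bailey_step_kernel[OF assms] mult_ac)
qed

lemma bailey_step_iterate:
  assumes "norm q < 1" "z \<noteq> 0"
  shows "(bailey_step q ^^ k) (bailey_beta q z)
    = (\<lambda>n. \<Sum>r\<le>n. bailey_weight q r ^ k * bailey_alpha q z r * bailey_kernel q r n)"
proof (induction k)
  case 0
  show ?case using bailey_beta_eq[OF assms] by auto
next
  case (Suc k)
  have "(bailey_step q ^^ Suc k) (bailey_beta q z) = bailey_step q ((bailey_step q ^^ k) (bailey_beta q z))"
    by simp
  then show ?case
    unfolding Suc.IH bailey_step_sum_kernel[OF assms(1)] by (simp add: mult.assoc)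
qed

subsection \<open>Convergence and bounds\<close>

text \<open>Tannery's theorem for unordered sums: the Weierstrass M-test makes the finite partial
  sums converge uniformly in N, so the two limits may be interchanged.\<close>

lemma infsum_dominated_convergence:
  fixes f :: "nat \<Rightarrow> 'a \<Rightarrow> 'b :: banach"
  assumes bound: "\<And>N x. x \<in> A \<Longrightarrow> norm (f N x) \<le> g x"
    and g: "g summable_on A"
    and lim: "\<And>x. x \<in> A \<Longrightarrow> (\<lambda>N. f N x) \<longlonglongrightarrow> h x"
  shows "(\<lambda>N. \<Sum>\<^sub>\<infinity>x\<in>A. f N x) \<longlonglongrightarrow> (\<Sum>\<^sub>\<infinity>x\<in>A. h x)"
proof (rule swap_uniform_limit')
  have "norm (h x) \<le> g x" if "x \<in> A" for x
    by (rule tendsto_upperbound[OF tendsto_norm[OF lim[OF that]]]) (auto simp: bound that)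
  then have "(\<lambda>x. norm (h x)) summable_on A"
    by (rule Infinite_Sum.abs_summable_on_comparison_test'[OF g])
  then show "((\<lambda>X. \<Sum>x\<in>X. h x) \<longlongrightarrow> (\<Sum>\<^sub>\<infinity>x\<in>A. h x)) (finite_subsets_at_top A)"
    using abs_summable_summable has_sum_infsum unfolding has_sum_def by blast
  show "uniform_limit UNIV (\<lambda>X N. \<Sum>x\<in>X. f N x) (\<lambda>N. \<Sum>\<^sub>\<infinity>x\<in>A. f N x) (finite_subsets_at_top A)"
    by (rule Weierstrass_m_test_general[OF _ g]) (simp add: bound)
  show "\<forall>\<^sub>F X in finite_subsets_at_top A. ((\<lambda>N. \<Sum>x\<in>X. f N x) \<longlongrightarrow> (\<Sum>x\<in>X. h x)) sequentially"
    by (rule eventually_finite_subsets_at_top_weakI) (auto intro!: tendsto_sum lim)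
qed auto

lemma summable_power_choose_two:
  fixes c y :: real
  assumes "0 \<le> c" "c < 1" "0 \<le> y"
  shows "summable (\<lambda>n. c ^ (Suc n choose 2) * y ^ n)"
proof -
  \<comment> \<open>This is the ratio of consecutive terms; it tends to 0, so it is eventually below
    1/2.\<close>
  have "(\<lambda>n. c ^ Suc n * y) \<longlonglongrightarrow> 0 * y"
    using assms by (intro tendsto_mult_right LIMSEQ_Suc LIMSEQ_realpow_zero)
  then have "\<forall>\<^sub>F n in sequentially. c ^ Suc n * y < 1 / 2"
    by (rule order_tendstoD) simp
  then obtain N where N: "\<And>n. n \<ge> N \<Longrightarrow> c ^ Suc n * y < 1 / 2"
    unfolding eventually_sequentially by auto
  show ?thesis
  proof (rule summable_ratio_test)
    fix n assume "n \<ge> N"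
    have "c ^ (Suc (Suc n) choose 2) * y ^ Suc n = (c ^ Suc n * y) * (c ^ (Suc n choose 2) * y ^ n)"
      by (simp add: numeral_2_eq_2 power_add mult_ac)
    also have "\<dots> \<le> 1 / 2 * (c ^ (Suc n choose 2) * y ^ n)"
      using N[OF \<open>n \<ge> N\<close>] assms by (intro mult_right_mono) auto
    finally show "norm (c ^ (Suc (Suc n) choose 2) * y ^ Suc n)
        \<le> 1 / 2 * norm (c ^ (Suc n choose 2) * y ^ n)"
      using assms by simp
  qed simp
qed

lemma convergent_prod_one_minus_geometric:
  fixes a q :: complex
  assumes "norm q < 1"
  shows "convergent_prod (\<lambda>n. 1 - a * q ^ n)"
proof (rule abs_convergent_prod_imp_convergent_prod, rule summable_imp_abs_convergent_prod)
  show "summable (\<lambda>i. norm (1 - a * q ^ i - 1))"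
    using assms by (simp add: norm_mult norm_power summable_mult summable_geometric)
qed

lemma qpoch_eq_prod_atMost: "qpoch a q (Suc n) = (\<Prod>i\<le>n. 1 - a * q ^ i)"
  by (induction n) (simp_all add: qpoch_Suc)

lemma qpoch_bounded:
  assumes "norm q < 1"
  obtains C where "\<And>n. norm (qpoch a q n) \<le> C"
proof -
  have "convergent (\<lambda>n. qpoch a q (Suc n))"
    unfolding qpoch_eq_prod_atMost
    by (intro convergent_prod_imp_convergent convergent_prod_one_minus_geometric assms)
  then have "Bseq (qpoch a q)"
    by (intro convergent_imp_Bseq) (simp add: convergent_Suc_iff)
  then show ?thesis
    using that by (auto simp: Bseq_def)
qed

text \<open>A convergent infinite product without zero factors has a nonzero limit. Nonvanishing is
  what bounds 1/(q)_n and lets the factors L cancel later.\<close>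

lemma qfact_tendsto:
  assumes "norm q < 1"
  obtains L where "L \<noteq> 0" "qfact q \<longlonglongrightarrow> L"
proof -
  have "\<exists>L. (\<lambda>n. \<Prod>i\<le>n. 1 - q * q ^ i) \<longlonglongrightarrow> L \<and> L \<noteq> 0"
    using convergent_prod_one_minus_geometric[OF assms, of q]
    by (subst (asm) convergent_prod_iff_nz_lim) (use one_minus_power_nonzero[OF assms] in auto)
  then obtain L where "(\<lambda>n. qfact q (Suc n)) \<longlonglongrightarrow> L" "L \<noteq> 0"
    unfolding qpoch_eq_prod_atMost by blast
  then show ?thesis
    using that LIMSEQ_imp_Suc by blast
qed

lemma inverse_qfact_bounded:
  assumes "norm q < 1"
  obtains C where "\<And>n. norm (1 / qfact q n) \<le> C"
proof -
  obtain L where "L \<noteq> 0" "qfact q \<longlonglongrightarrow> L"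
    using qfact_tendsto[OF assms] .
  then have "Bseq (\<lambda>n. 1 / qfact q n)"
    by (intro convergent_imp_Bseq convergentI[of _ "1 / L"] tendsto_intros)
  then show ?thesis
    using that by (auto simp: Bseq_def)
qed

text \<open>Rewriting the denominator as (q)_(2n+1) / (q)_n leaves four factors, each bounded
  uniformly in n.\<close>

lemma bailey_beta_bounded:
  assumes "norm q < 1"
  obtains B where "\<And>n. norm (bailey_beta q z n) \<le> B"
proof -
  obtain C1 where C1: "\<And>n. norm (qpoch (-1 / z) q n) \<le> C1"
    using qpoch_bounded[OF assms, where a = "-1 / z"] by blast
  obtain C2 where C2: "\<And>n. norm (qpoch (- z * q) q n) \<le> C2"
    using qpoch_bounded[OF assms, where a = "- z * q"] by blast
  obtain C3 where C3: "\<And>n. norm (qfact q n) \<le> C3"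
    using qpoch_bounded[OF assms, where a = q] by blast
  obtain C4 where C4: "\<And>n. norm (1 / qfact q n) \<le> C4"
    using inverse_qfact_bounded[OF assms] by blast
  have nonneg: "0 \<le> C1" "0 \<le> C2" "0 \<le> C3" "0 \<le> C4"
    by (rule order_trans[OF norm_ge_zero], fact C1 C2 C3 C4)+
  have "norm (bailey_beta q z n) \<le> C1 * C2 * C3 * C4" for n
  proof -
    have eq: "bailey_beta q z n = qpoch (-1 / z) q (n + 1) * qpoch (- z * q) q n * qfact q n
        * (1 / qfact q (2 * n + 1))"
      unfolding bailey_beta_def qpoch_shifted_eq[OF assms] by simp
    show ?thesis
      unfolding eq norm_mult
      by (intro mult_mono C1 C2 C3 C4 mult_nonneg_nonneg nonneg norm_ge_zero)
  qed
  then show ?thesis using that by blast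
qed

subsection \<open>Sums over decreasing tuples\<close>

text \<open>The innermost function \<open>g\<close> is kept general so that an induction on
  \<open>k\<close> can replace it by \<open>bailey_step q g\<close>.\<close>

definition tuple_term :: "complex \<Rightarrow> nat \<Rightarrow> (nat \<Rightarrow> complex) \<Rightarrow> (nat \<Rightarrow> nat) \<Rightarrow> complex" where
  "tuple_term q k g n = (\<Prod>i=1..k. bailey_weight q (n i)) * g (n k)
     / (\<Prod>i\<in>{1..<k}. qfact q (n i - n (i + 1)))"

lemma lhs_term_eq_tuple_term: "lhs_term k q z = tuple_term q k (bailey_beta q z)"
  by (rule ext) (simp add: lhs_term_def tuple_term_def bailey_beta_def bailey_weight_def
    power_sum prod.distrib mult_ac del: binomial_Suc_Suc)

lemma norm_bailey_weight_le:
  assumes "norm q < 1"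
  shows "norm (bailey_weight q j) \<le> norm q ^ j"
proof -
  have "j \<le> Suc j choose 2" by (simp add: numeral_2_eq_2)
  then show ?thesis
    using assms by (simp add: bailey_weight_def norm_mult norm_power power_decreasing del: binomial_Suc_Suc)
qed

text \<open>Weakening the quadratic exponents to linear ones gives a majorant that is a product of
  independent geometric series on the full box of tuples. The k - 1 inverse q-factorials and
  \<open>g\<close> contribute only the constant \<open>B * C ^ (k - 1)\<close>.\<close>

lemma tuple_term_abs_summable:
  assumes "norm q < 1" "\<And>n. norm (g n) \<le> B"
  shows "(\<lambda>n. norm (tuple_term q k g n)) summable_on decr_tuples k"
proof -
  obtain C where C: "\<And>n. norm (1 / qfact q n) \<le> C"
    using inverse_qfact_bounded[OF assms(1)] by blast
  have nonneg: "0 \<le> C" "0 \<le> B"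
    by (rule order_trans[OF norm_ge_zero], fact C assms(2))+
  define h where "h = (\<lambda>n::nat \<Rightarrow> nat. \<Prod>i\<in>{1..k}. norm q ^ n i)"
  have "Infinite_Set_Sum.abs_summable_on h ({1..k} \<rightarrow>\<^sub>E UNIV)"
    unfolding h_def
    by (intro abs_summable_on_prod_PiE)
       (use assms in \<open>auto simp: abs_summable_on_nat_iff' summable_geometric\<close>)
  then have "(\<lambda>n. norm (h n)) summable_on ({1..k} \<rightarrow>\<^sub>E UNIV)"
    by (simp only: abs_summable_equivalent)
  then have "h summable_on ({1..k} \<rightarrow>\<^sub>E UNIV)"
    by (rule abs_summable_summable)
  then have "h summable_on decr_tuples k"
    by (rule summable_on_subset_banach) (auto simp: decr_tuples_def)
  then have "(\<lambda>n. (B * C ^ (k - 1)) * h n) summable_on decr_tuples k"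
    by (rule summable_on_cmult_right)
  then show ?thesis
  proof (rule Infinite_Sum.abs_summable_on_comparison_test')
    fix n
    have "norm (\<Prod>i=1..k. bailey_weight q (n i)) \<le> h n"
      unfolding h_def prod_norm[symmetric]
      by (intro prod_mono) (auto intro: norm_bailey_weight_le assms)
    moreover have "norm (\<Prod>i\<in>{1..<k}. 1 / qfact q (n i - n (i + 1))) \<le> (\<Prod>i\<in>{1..<k}. C)"
      unfolding prod_norm[symmetric] by (intro prod_mono) (auto intro: C)
    moreover have "0 \<le> h n" by (auto simp: h_def intro: prod_nonneg)
    ultimately have "norm (\<Prod>i=1..k. bailey_weight q (n i)) * norm (g (n k))
        * norm (\<Prod>i\<in>{1..<k}. 1 / qfact q (n i - n (i + 1))) \<le> h n * B * C ^ (k - 1)"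
      using assms(2) nonneg by (intro mult_mono mult_nonneg_nonneg) auto
    moreover have "tuple_term q k g n = (\<Prod>i=1..k. bailey_weight q (n i)) * g (n k)
        * (\<Prod>i\<in>{1..<k}. 1 / qfact q (n i - n (i + 1)))"
      by (simp add: tuple_term_def prod_dividef)
    ultimately show "norm (tuple_term q k g n) \<le> (B * C ^ (k - 1)) * h n"
      by (simp add: norm_mult mult_ac)
  qed
qed

section \<open>Truncated tuple sums, evaluated from the innermost coordinate\<close>

lemma decr_tuples_le_first:
  assumes "n \<in> decr_tuples k" "1 \<le> i" "i \<le> k"
  shows "n i \<le> n 1"
  using assms(2,3)
proof (induction i rule: dec_induct)
  case (step i)
  then have "n (i + 1) \<le> n i"
    using assms(1) by (auto simp: decr_tuples_def)
  then show ?case using step by simp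
qed simp

definition bounded_decr_tuples :: "nat \<Rightarrow> nat \<Rightarrow> (nat \<Rightarrow> nat) set" where
  "bounded_decr_tuples k N = {n \<in> decr_tuples k. n 1 \<le> N}"

lemma finite_bounded_decr_tuples: "finite (bounded_decr_tuples k N)"
proof (rule finite_subset)
  show "bounded_decr_tuples k N \<subseteq> ({1..k} \<rightarrow>\<^sub>E {..N})"
  proof
    fix n assume "n \<in> bounded_decr_tuples k N"
    then have n: "n \<in> decr_tuples k" "n 1 \<le> N"
      by (auto simp: bounded_decr_tuples_def)
    then have "n i \<le> N" if "i \<in> {1..k}" for i
      using decr_tuples_le_first[OF n(1), of i] that by auto
    then show "n \<in> ({1..k} \<rightarrow>\<^sub>E {..N})"
      using n(1) by (auto simp: decr_tuples_def PiE_def)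
  qed
qed (intro finite_PiE; simp)

lemma sum_bounded_decr_tuples_1:
  "(\<Sum>n\<in>bounded_decr_tuples 1 N. F n) = (\<Sum>m\<le>N. F ((\<lambda>_. undefined)(1 := m)))"
  by (rule sum.reindex_bij_witness[of _ "\<lambda>m. (\<lambda>_. undefined)(1 := m)" "\<lambda>n. n 1"])
     (auto simp: bounded_decr_tuples_def decr_tuples_def PiE_def extensional_def fun_eq_iff
       intro!: arg_cong[where f = F])

lemma sum_bounded_decr_tuples_Suc:
  assumes "k \<ge> 1"
  shows "(\<Sum>n\<in>bounded_decr_tuples (Suc k) N. F n)
    = (\<Sum>n\<in>bounded_decr_tuples k N. \<Sum>m\<le>n k. F (n(Suc k := m)))"
proof -
  have "(\<Sum>n\<in>bounded_decr_tuples k N. \<Sum>m\<le>n k. F (n(Suc k := m)))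
    = (\<Sum>(n, m)\<in>(SIGMA n:bounded_decr_tuples k N. {..n k}). F (n(Suc k := m)))"
    by (rule sum.Sigma) (auto simp: finite_bounded_decr_tuples)
  also have "\<dots> = (\<Sum>n\<in>bounded_decr_tuples (Suc k) N. F n)"
  \<comment> \<open>Resetting coordinate k + 1 to \<open>undefined\<close> inverts the update, as an
    encoded k-tuple is \<open>undefined\<close> there.\<close>
  proof (rule sum.reindex_bij_witness[of _ "\<lambda>n. (n(Suc k := undefined), n (Suc k))"
        "\<lambda>(n, m). n(Suc k := m)"])
    fix p assume "p \<in> (SIGMA n:bounded_decr_tuples k N. {..n k})"
    then obtain n m where p: "p = (n, m)" "n \<in> bounded_decr_tuples k N" "m \<le> n k" by auto
    then have "n (Suc k) = undefined"
      by (auto simp: bounded_decr_tuples_def decr_tuples_def PiE_def extensional_def)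
    then show "(((case p of (n, m) \<Rightarrow> n(Suc k := m)))(Suc k := undefined),
        (case p of (n, m) \<Rightarrow> n(Suc k := m)) (Suc k)) = p"
      using p(1) by (auto simp: fun_eq_iff)
    show "(case p of (n, m) \<Rightarrow> n(Suc k := m)) \<in> bounded_decr_tuples (Suc k) N"
      using p assms by (auto simp: bounded_decr_tuples_def decr_tuples_def PiE_def extensional_def)
  next
    fix n assume n: "n \<in> bounded_decr_tuples (Suc k) N"
    then have "n (k + 1) \<le> n k"
      using assms unfolding bounded_decr_tuples_def decr_tuples_def by fastforce
    then show "(n(Suc k := undefined), n (Suc k)) \<in> (SIGMA n:bounded_decr_tuples k N. {..n k})"
      using n assms by (auto simp: bounded_decr_tuples_def decr_tuples_def PiE_def extensional_def)
  qed auto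
  finally show ?thesis ..
qed

lemma tuple_term_Suc:
  assumes "k \<ge> 1"
  shows "tuple_term q (Suc k) g (n(Suc k := m)) = (\<Prod>i=1..k. bailey_weight q (n i))
     / (\<Prod>i\<in>{1..<k}. qfact q (n i - n (i + 1))) * (bailey_weight q m * g m / qfact q (n k - m))"
proof -
  have "(\<Prod>i=1..Suc k. bailey_weight q ((n(Suc k := m)) i)) = (\<Prod>i=1..k. bailey_weight q (n i)) * bailey_weight q m"
    by (simp add: prod.nat_ivl_Suc')
  moreover have "(\<Prod>i\<in>{1..<Suc k}. qfact q ((n(Suc k := m)) i - (n(Suc k := m)) (i + 1)))
      = (\<Prod>i\<in>{1..<k}. qfact q (n i - n (i + 1))) * qfact q (n k - m)"
    using assms by (simp add: prod.atLeastLessThan_Suc)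
  ultimately show ?thesis
    unfolding tuple_term_def by simp
qed

text \<open>Summing over the innermost coordinate m \<le> n_k replaces \<open>g\<close> by
  \<open>bailey_step q g\<close>, hence the induction with \<open>g\<close> arbitrary. The extra
  factor 1/(q)_(N-n_1) makes the outermost sum a step as well.\<close>

lemma sum_tuple_term:
  assumes "k \<ge> 1"
  shows "(\<Sum>n\<in>bounded_decr_tuples k N. tuple_term q k g n / qfact q (N - n 1))
    = (bailey_step q ^^ k) g N"
  using assms
proof (induction k arbitrary: g rule: nat_induct_at_least)
  case base
  show ?case
    unfolding sum_bounded_decr_tuples_1 by (simp add: tuple_term_def bailey_step_def)
next
  case (Suc k)
  have "(\<Sum>n\<in>bounded_decr_tuples (Suc k) N. tuple_term q (Suc k) g n / qfact q (N - n 1))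
      = (\<Sum>n\<in>bounded_decr_tuples k N. tuple_term q k (bailey_step q g) n / qfact q (N - n 1))"
    unfolding sum_bounded_decr_tuples_Suc[OF Suc.hyps] tuple_term_Suc[OF Suc.hyps]
    using Suc.hyps
    by (intro sum.cong refl)
       (simp add: tuple_term_def bailey_step_def sum_distrib_left sum_divide_distrib mult_ac)
  also have "\<dots> = (bailey_step q ^^ Suc k) g N"
    unfolding Suc.IH by (simp add: funpow_swap1)
  finally show ?case .
qed

section \<open>The series on the right-hand side\<close>

lemma bailey_weight_power_alpha:
  "bailey_weight q r ^ k * bailey_alpha q z r = rhs_term k q z r"
  by (simp add: bailey_weight_def bailey_alpha_def rhs_term_def power_mult_distrib power_mult[symmetric]
    power_add mult_ac del: binomial_Suc_Suc)

text \<open>For every \<open>k\<close> the exponent of |q| is at least C(n+1,2), which outweighs the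
  geometric growth of both |z|^n and |1/z|^n.\<close>

lemma rhs_term_abs_summable:
  assumes "norm q < 1"
  shows "summable (\<lambda>n. norm (rhs_term k q z n))"
proof (rule summable_comparison_test')
  let ?c = "\<lambda>n. norm q ^ (Suc n choose 2)"
  show "summable (\<lambda>n. ?c n * norm z ^ n + norm (1 / z) * (?c n * norm (1 / z) ^ n))"
    using assms by (intro summable_add summable_mult summable_power_choose_two) auto
  fix n :: nat
  have "z powi (- int n - 1) = (1 / z) * (1 / z) ^ n"
  proof -
    have "- int n - 1 = - int (Suc n)" by simp
    then show ?thesis by (simp only: power_int_minus power_int_of_nat) (simp add: field_simps)
  qed
  then have "norm (z ^ n + z powi (- int n - 1)) \<le> norm z ^ n + norm (1 / z) * norm (1 / z) ^ n"
    by (metis norm_mult norm_power norm_triangle_ineq)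
  moreover have "norm q ^ ((k + 1) * (Suc n choose 2)) \<le> ?c n"
    using assms by (intro power_decreasing) auto
  ultimately have "norm q ^ ((k + 1) * (Suc n choose 2)) * norm (z ^ n + z powi (- int n - 1))
      \<le> ?c n * (norm z ^ n + norm (1 / z) * norm (1 / z) ^ n)"
    by (intro mult_mono) auto
  then show "norm (norm (rhs_term k q z n))
      \<le> ?c n * norm z ^ n + norm (1 / z) * (?c n * norm (1 / z) ^ n)"
    unfolding rhs_term_def Suc_eq_plus1[symmetric] norm_mult
    by (simp add: norm_mult norm_power distrib_left mult_ac del: binomial_Suc_Suc mult_Suc)
qed

subsection \<open>Passage to the limit\<close>

text \<open>For a fixed tuple (q)_N / (q)_(N-n_1) tends to L / L = 1 and is bounded uniformly, so a
  multiple of the norm of the summand dominates.\<close>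

lemma sum_lhs_term_tendsto:
  assumes "k \<ge> 1" "norm q < 1"
  shows "(\<lambda>N. qfact q N * (\<Sum>n\<in>bounded_decr_tuples k N. lhs_term k q z n / qfact q (N - n 1)))
    \<longlonglongrightarrow> (\<Sum>\<^sub>\<infinity>n\<in>decr_tuples k. lhs_term k q z n)"
proof -
  obtain B where B: "\<And>n. norm (bailey_beta q z n) \<le> B"
    using bailey_beta_bounded[OF assms(2)] by blast
  obtain C where C: "\<And>n. norm (qfact q n) \<le> C"
    using qpoch_bounded[OF assms(2), where a = q] by blast
  obtain C' where C': "\<And>n. norm (1 / qfact q n) \<le> C'"
    using inverse_qfact_bounded[OF assms(2)] by blast
  have nonneg: "0 \<le> C" "0 \<le> C'"
    by (rule order_trans[OF norm_ge_zero], fact C C')+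
  obtain L where L: "L \<noteq> 0" "qfact q \<longlonglongrightarrow> L"
    using qfact_tendsto[OF assms(2)] .
  \<comment> \<open>Extension by zero beyond n_1 \<le> N puts all truncated sums on the same index
    set.\<close>
  define f where "f = (\<lambda>N n. if n 1 \<le> N then qfact q N * (1 / qfact q (N - n 1)) * lhs_term k q z n else 0)"
  have "(\<lambda>N. \<Sum>\<^sub>\<infinity>n\<in>decr_tuples k. f N n) \<longlonglongrightarrow> (\<Sum>\<^sub>\<infinity>n\<in>decr_tuples k. lhs_term k q z n)"
  proof (rule infsum_dominated_convergence)
    show "(\<lambda>n. (C * C') * norm (lhs_term k q z n)) summable_on decr_tuples k"
      unfolding lhs_term_eq_tuple_term
      by (intro summable_on_cmult_right tuple_term_abs_summable[OF assms(2) B])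
    fix n
    show "norm (f N n) \<le> (C * C') * norm (lhs_term k q z n)" for N
      unfolding f_def using nonneg
      by (auto simp only: norm_mult split: if_splits
          intro!: mult_mono C C' mult_nonneg_nonneg norm_ge_zero order_refl) auto
    have "(\<lambda>N. qfact q (N - n 1)) \<longlonglongrightarrow> L"
      using L(2) by (rule filterlim_compose[OF _ filterlim_minus_const_nat_at_top])
    then have "(\<lambda>N. qfact q N * (1 / qfact q (N - n 1)) * lhs_term k q z n)
        \<longlonglongrightarrow> L * (1 / L) * lhs_term k q z n"
      using L by (intro tendsto_intros)
    moreover have "\<forall>\<^sub>F N in sequentially. f N n = qfact q N * (1 / qfact q (N - n 1)) * lhs_term k q z n"
      using eventually_ge_at_top[of "n 1"] by eventually_elim (simp add: f_def)
    ultimately show "(\<lambda>N. f N n) \<longlonglongrightarrow> lhs_term k q z n"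
      using L(1) by (simp add: tendsto_cong)
  qed
  moreover have "(\<Sum>\<^sub>\<infinity>n\<in>decr_tuples k. f N n)
      = qfact q N * (\<Sum>n\<in>bounded_decr_tuples k N. lhs_term k q z n / qfact q (N - n 1))" for N
  proof -
    have "(\<Sum>\<^sub>\<infinity>n\<in>decr_tuples k. f N n) = (\<Sum>\<^sub>\<infinity>n\<in>bounded_decr_tuples k N. f N n)"
      by (rule infsum_cong_neutral) (auto simp: bounded_decr_tuples_def f_def)
    also have "\<dots> = (\<Sum>n\<in>bounded_decr_tuples k N. f N n)"
      by (simp add: finite_bounded_decr_tuples)
    finally show ?thesis
      by (simp add: f_def bounded_decr_tuples_def sum_distrib_left)
  qed
  ultimately show ?thesis by simp
qed

text \<open>(q)_N times the kernel is (q)_N^2 / ((q)_(N-r) (q)_(N+r+1)), which is bounded uniformly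
  in r and N and tends to 1 for fixed r.\<close>

lemma sum_rhs_term_tendsto:
  assumes "norm q < 1"
  shows "(\<lambda>N. qfact q N * (\<Sum>r\<le>N. rhs_term k q z r * bailey_kernel q r N))
    \<longlonglongrightarrow> (\<Sum>r. rhs_term k q z r)"
proof -
  obtain C where C: "\<And>n. norm (qfact q n) \<le> C"
    using qpoch_bounded[OF assms, where a = q] by blast
  obtain C' where C': "\<And>n. norm (1 / qfact q n) \<le> C'"
    using inverse_qfact_bounded[OF assms] by blast
  have nonneg: "0 \<le> C" "0 \<le> C'"
    by (rule order_trans[OF norm_ge_zero], fact C C')+
  obtain L where L: "L \<noteq> 0" "qfact q \<longlonglongrightarrow> L"
    using qfact_tendsto[OF assms] .
  have kernel: "qfact q N * bailey_kernel q r N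
      = qfact q N * qfact q N * (1 / qfact q (N - r)) * (1 / qfact q (N + r + 1))" if "r \<le> N" for r N
    using that by (simp add: bailey_kernel_def)
  have bound: "norm (qfact q N * bailey_kernel q r N) \<le> C * C * C' * C'" for r N
  proof (cases "r \<le> N")
    case True
    show ?thesis
      unfolding kernel[OF True] norm_mult
      by (intro mult_mono C C' mult_nonneg_nonneg nonneg norm_ge_zero)
  next
    case False
    then show ?thesis using nonneg by (simp add: bailey_kernel_def)
  qed
  have lim: "(\<lambda>N. qfact q N * bailey_kernel q r N) \<longlonglongrightarrow> 1" for r
  proof -
    have 1: "(\<lambda>N. qfact q (N - r)) \<longlonglongrightarrow> L"
      using L(2) by (rule filterlim_compose[OF _ filterlim_minus_const_nat_at_top])
    have 2: "(\<lambda>N. qfact q (N + r + 1)) \<longlonglongrightarrow> L"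
      using LIMSEQ_ignore_initial_segment[OF L(2), of "r + 1"] by (simp add: add.assoc)
    have "(\<lambda>N. qfact q N * qfact q N * (1 / qfact q (N - r)) * (1 / qfact q (N + r + 1)))
        \<longlonglongrightarrow> L * L * (1 / L) * (1 / L)"
      using L 1 2 by (intro tendsto_intros)
    moreover have "\<forall>\<^sub>F N in sequentially. qfact q N * bailey_kernel q r N
        = qfact q N * qfact q N * (1 / qfact q (N - r)) * (1 / qfact q (N + r + 1))"
      using eventually_ge_at_top[of r] by eventually_elim (rule kernel)
    ultimately show ?thesis
      using L(1) by (simp add: tendsto_cong)
  qed
  have abs: "(\<lambda>r. norm (rhs_term k q z r)) summable_on UNIV"
    using rhs_term_abs_summable[OF assms] by (intro norm_summable_imp_summable_on) simp
  have "(\<lambda>N. \<Sum>\<^sub>\<infinity>r\<in>UNIV. rhs_term k q z r * (qfact q N * bailey_kernel q r N))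
      \<longlonglongrightarrow> (\<Sum>\<^sub>\<infinity>r\<in>UNIV. rhs_term k q z r)"
  proof (rule infsum_dominated_convergence)
    show "(\<lambda>r. norm (rhs_term k q z r) * (C * C * C' * C')) summable_on UNIV"
      by (intro summable_on_cmult_left abs)
    fix r
    show "norm (rhs_term k q z r * (qfact q N * bailey_kernel q r N))
        \<le> norm (rhs_term k q z r) * (C * C * C' * C')" for N
      unfolding norm_mult[of "rhs_term k q z r"] by (intro mult_left_mono bound norm_ge_zero)
    show "(\<lambda>N. rhs_term k q z r * (qfact q N * bailey_kernel q r N)) \<longlonglongrightarrow> rhs_term k q z r"
      using tendsto_mult_left[OF lim[of r], of "rhs_term k q z r"] by simp
  qed
  moreover have "(\<Sum>\<^sub>\<infinity>r\<in>UNIV. rhs_term k q z r * (qfact q N * bailey_kernel q r N))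
      = qfact q N * (\<Sum>r\<le>N. rhs_term k q z r * bailey_kernel q r N)" for N
  proof -
    have "(\<Sum>\<^sub>\<infinity>r\<in>UNIV. rhs_term k q z r * (qfact q N * bailey_kernel q r N))
        = (\<Sum>\<^sub>\<infinity>r\<in>{..N}. rhs_term k q z r * (qfact q N * bailey_kernel q r N))"
      by (rule infsum_cong_neutral) (auto simp: bailey_kernel_def)
    then show ?thesis by (simp add: sum_distrib_left mult_ac)
  qed
  moreover have "(\<Sum>\<^sub>\<infinity>r\<in>UNIV. rhs_term k q z r) = (\<Sum>r. rhs_term k q z r)"
    using norm_summable_imp_has_sum[OF rhs_term_abs_summable[OF assms]]
      summable_sums[OF summable_norm_cancel[OF rhs_term_abs_summable[OF assms]]]
    by (intro infsumI) auto
  ultimately show ?thesis by simp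
qed

theorem theorem5p5:
  fixes k :: nat and q z :: complex
  assumes "k \<ge> 1" and "norm q < 1" and "z \<noteq> 0"
  shows "lhs_term k q z summable_on decr_tuples k
       \<and> summable (rhs_term k q z)
       \<and> (\<Sum>\<^sub>\<infinity>n\<in>decr_tuples k. lhs_term k q z n) = (\<Sum>n. rhs_term k q z n)"
proof (intro conjI)
  obtain B where B: "\<And>n. norm (bailey_beta q z n) \<le> B"
    using bailey_beta_bounded[OF assms(2)] by blast
  show "lhs_term k q z summable_on decr_tuples k"
    unfolding lhs_term_eq_tuple_term
    by (rule abs_summable_summable[OF tuple_term_abs_summable[OF assms(2) B]])
  show "summable (rhs_term k q z)"
    using summable_norm_cancel[OF rhs_term_abs_summable[OF assms(2)]] .
  \<comment> \<open>Both sides are the k-fold step applied to beta, evaluated at N: once by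
    unfolding the tuples, once by the eigenfunction expansion.\<close>
  have eq: "(\<Sum>n\<in>bounded_decr_tuples k N. lhs_term k q z n / qfact q (N - n 1))
      = (\<Sum>r\<le>N. rhs_term k q z r * bailey_kernel q r N)" for N
    unfolding lhs_term_eq_tuple_term sum_tuple_term[OF assms(1)] bailey_step_iterate[OF assms(2,3)]
      bailey_weight_power_alpha ..
  \<comment> \<open>After multiplication by (q)_N the common finite value tends to each of the two
    infinite sums.\<close>
  show "(\<Sum>\<^sub>\<infinity>n\<in>decr_tuples k. lhs_term k q z n) = (\<Sum>n. rhs_term k q z n)"
    using LIMSEQ_unique[OF sum_lhs_term_tendsto[OF assms(1,2), of z, unfolded eq]
        sum_rhs_term_tendsto[OF assms(2), of k z]] .
qed

end
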